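(* Let $q\geq 3$ be a prime power, $m\geq 2$, $n=q^m-1$, and $2\le\delta\le n$. Then $\mathcal{C}_{(q,n,\delta,2)}$ is a dually-BCH code if and only if $$(q-1)q^{m-1}-q^{\lfloor \frac{m-1}{2}\rfloor}-1\leq \delta\leq q^m-2.$$
   Context: Let $\alpha$ be a generator of $\mathbb{F}_{q^m}^*$; it is a primitive $n$-th root of unity for $n=q^m-1$. For an integer $j$ (read modulo $n$) let $m_j(x)$ be the minimal polynomial of $\alpha^j$ over $\mathbb{F}_q$. For integers $b\ge 1$ and $2\le\delta\le n$, the BCH code $\mathcal{C}_{(q,n,\delta,b)}$ with respect to $\alpha$ is the cyclic code of length $n$ over $\mathbb{F}_q$ (an ideal of $\mathbb{F}_q[x]/\langle x^n-1\rangle$) generated by $\mathrm{lcm}(m_b(x),m_{b+1}(x),\dots,m_{b+\delta-2}(x))$. A BCH code is called dually-BCH if its dual code (with respect to the standard inner product) is again a BCH code $\mathcal{C}_{(q,n,\delta',b')}$ with respect to the same primitive $n$-th root of unity, for some $b'$ and $\delta'$. *)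

theory Defs
  imports
    "HOL-Computational_Algebra.Polynomial_Factorial"
    "HOL-Number_Theory.Prime_Powers"
    "Berlekamp_Zassenhaus.Finite_Field"
begin

text \<open>
  The extension of finite fields is given by a field homomorphism \<open>h\<close> from the small field
  (type variable \<open>'f\<close>) into the large one (type variable \<open>'e\<close>). The class \<^class>\<open>field_gcd\<close>
  only adds to a field its (forced) trivial gcd operations, so it is no restriction on the
  field; it makes \<^const>\<open>Lcm\<close> available on polynomials, normalised to be monic.
\<close>

definition min_poly :: "('f::field \<Rightarrow> 'e::field) \<Rightarrow> 'e \<Rightarrow> 'f poly" where
  "min_poly h x = (THE p. lead_coeff p = 1 \<and> poly (map_poly h p) x = 0 \<and>
     (\<forall>p'. p' \<noteq> 0 \<and> poly (map_poly h p') x = 0 \<longrightarrow> degree p \<le> degree p'))"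

text \<open>
  A residue class modulo \<open>x^n - 1\<close> is represented by its remainder. A code of length \<open>n\<close> is thus
  a set of polynomials of degree below \<open>n\<close>, whose coefficient vectors are the codewords.
\<close>

definition cyclic_code :: "nat \<Rightarrow> 'f::field poly \<Rightarrow> 'f poly set" where
  "cyclic_code n g = range (\<lambda>f. (f * g) mod (Polynomial.monom 1 n - 1))"

definition dual_code :: "nat \<Rightarrow> 'f::field poly set \<Rightarrow> 'f poly set" where
  "dual_code n C = {d. degree d < n \<and>
     (\<forall>c\<in>C. (\<Sum>i<n. poly.coeff c i * poly.coeff d i) = 0)}"

definition bch_code ::
  "('f::field_gcd \<Rightarrow> 'e::field) \<Rightarrow> 'e \<Rightarrow> nat \<Rightarrow> nat \<Rightarrow> nat \<Rightarrow> 'f poly set" where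
  "bch_code h \<alpha> n \<delta> b = cyclic_code n (Lcm ((\<lambda>j. min_poly h (\<alpha> ^ j)) ` {b..b + \<delta> - 2}))"

definition is_bch_code ::
  "('f::field_gcd \<Rightarrow> 'e::field) \<Rightarrow> 'e \<Rightarrow> nat \<Rightarrow> 'f poly set \<Rightarrow> bool" where
  "is_bch_code h \<alpha> n C \<longleftrightarrow> (\<exists>b \<delta>. 1 \<le> b \<and> 2 \<le> \<delta> \<and> \<delta> \<le> n \<and> C = bch_code h \<alpha> n \<delta> b)"

definition dually_bch ::
  "('f::field_gcd \<Rightarrow> 'e::field) \<Rightarrow> 'e \<Rightarrow> nat \<Rightarrow> 'f poly set \<Rightarrow> bool" where
  "dually_bch h \<alpha> n C \<longleftrightarrow> is_bch_code h \<alpha> n C \<and> is_bch_code h \<alpha> n (dual_code n C)"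

end

(*
  A word over the small field is determined by its values at the powers of alpha, and the bilinear
  form of two words is a Parseval sum of products of values at opposite powers. Hence the dual of
  the code with zeros alpha^j, j in S, has the zeros alpha^k where -k avoids the q-cyclotomic
  closure of S; trace words show that no further zeros occur and that a code determines the
  closure of its set of zeros. For S = {2..delta} the dual zeros are the k none of whose cyclic
  base-q digit shifts lies in [n - delta, n - 2], and the question is whether this set is the
  closure of an interval of residues modulo n.

  If n - delta is at most q^(m-1) + q^f, with f = (m - 1) div 2, then only 0 and possibly the powers
  of q survive, and the interval {0} or {0, 1} works. Otherwise q^(m-1) + q^f survives. As 0 is a
  dual zero and -2 is not, the interval has to reach from 0 up to suitable representatives of
  the dual zeros, and on the way it meets a number with a shift in the forbidden range.
*)

theory Submission
  imports Defs
begin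

section \<open>Cyclotomic cosets as cyclic digit shifts\<close>

definition coset_closure :: "nat \<Rightarrow> nat \<Rightarrow> nat set \<Rightarrow> nat set" where
  "coset_closure q n S = {k. \<exists>j\<in>S. \<exists>i. [k = j * q ^ i] (mod n)}"

text \<open>The interval consists of the residues \<open>-s\<close> with \<open>2 \<le> s \<le> \<delta>\<close>.\<close>

definition dual_zeros :: "nat \<Rightarrow> nat \<Rightarrow> nat \<Rightarrow> nat set" where
  "dual_zeros q n \<delta> = {k. \<forall>i. k * q ^ i mod n \<notin> {n - \<delta>..n - 2}}"

text \<open>Since \<open>q ^ m\<close> is 1 modulo n, multiplication by q rotates the m base-q
  digits of a residue.\<close>

locale cyclic_shift =
  fixes q m n :: nat
  assumes q_ge: "q \<ge> 3" and m_ge: "m \<ge> 2" and n_eq: "n = q ^ m - 1"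
begin

abbreviation "f \<equiv> (m - 1) div 2"

lemma q_power_pos [simp]: "q ^ i > 0"
  using q_ge by simp

lemma Suc_n: "q ^ m = Suc n"
  using n_eq q_power_pos[of m] by linarith

lemma q_power_Suc_ge: "3 * q ^ i \<le> q ^ Suc i"
  using q_ge by simp

lemma q_power_le: "i \<le> j \<Longrightarrow> q ^ i \<le> q ^ j"
  using q_ge by (simp add: power_increasing)

lemma q_power_m: "q ^ m = q * q ^ (m - 1)"
  using m_ge by (metis One_nat_def Suc_le_D diff_Suc_1 numeral_2_eq_2 power_Suc)

lemma n_large: "3 * q ^ (m - 1) \<le> Suc n" "q * q \<le> Suc n"
proof -
  show "3 * q ^ (m - 1) \<le> Suc n"
    using q_ge unfolding Suc_n[symmetric] q_power_m by simp
  show "q * q \<le> Suc n"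
    using q_power_le[OF m_ge] Suc_n by (simp add: power2_eq_square)
qed

lemma n_ge: "n \<ge> 8"
  using n_large(2) mult_le_mono[OF q_ge q_ge] by simp

lemma cong_q_power_m: "[q ^ m = 1] (mod n)"
  unfolding Suc_n cong_def by (metis mod_add_self2 plus_1_eq_Suc)

lemma cong_q_power_add: "[x * q ^ (m + i) = x * q ^ i] (mod n)"
proof -
  have "[x * q ^ i * q ^ m = x * q ^ i * 1] (mod n)"
    by (intro cong_mult cong_refl cong_q_power_m)
  then show ?thesis by (simp add: power_add mult_ac)
qed

lemma cong_q_power_mult: "[x * q ^ (m * i) = x] (mod n)"
proof -
  have "[x * (q ^ m) ^ i = x * 1 ^ i] (mod n)"
    by (intro cong_mult cong_refl cong_pow cong_q_power_m)
  then show ?thesis by (simp add: power_mult)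
qed

lemma cong_q_power_mod: "[x * q ^ i = x * q ^ (i mod m)] (mod n)"
  using cong_q_power_mult[of "x * q ^ (i mod m)" "i div m"]
  by (simp add: mult.assoc flip: power_add)

text \<open>The two powers of q multiply to a power of \<open>q ^ m\<close>, so the second undoes
  the first.\<close>

lemma cong_shift_back:
  assumes "[x * q ^ i = y] (mod n)"
  shows "[x = y * q ^ ((m - 1) * i)] (mod n)"
proof -
  have "[x = x * q ^ (m * i)] (mod n)"
    using cong_q_power_mult cong_sym by blast
  also have "x * q ^ (m * i) = x * q ^ i * q ^ ((m - 1) * i)"
    using m_ge by (simp add: mult.assoc add_mult_distrib2 algebra_simps flip: power_add)
  also have "[x * q ^ i * q ^ ((m - 1) * i) = y * q ^ ((m - 1) * i)] (mod n)"
    using assms by (intro cong_mult cong_refl)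
  finally show ?thesis .
qed

lemma in_coset_closure: "j \<in> S \<Longrightarrow> j \<in> coset_closure q n S"
  unfolding coset_closure_def by (auto intro!: bexI[of _ j] exI[of _ 0])

text \<open>The largest shift y of x has a nonzero leading digit, so smallness leaves
  \<open>y = q ^ (m - 1) + r\<close> with \<open>r < q ^ f\<close>. If r were nonzero, rotating its
  leading digit to the top would give a larger shift.\<close>

lemma small_shifts_imp_q_power:
  assumes small: "\<And>i. x * q ^ i mod n < q ^ (m - 1) + q ^ f" and "x mod n \<noteq> 0"
  shows "\<exists>i. [x = q ^ i] (mod n)"
proof -
  have "\<exists>i. True \<and> (\<forall>j. True \<longrightarrow> x * q ^ j mod n \<le> x * q ^ i mod n)"
    using small by (intro ex_has_greatest_nat[where b = "q ^ (m - 1) + q ^ f"]) auto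
  then obtain i where i: "\<And>j. x * q ^ j mod n \<le> x * q ^ i mod n" by auto
  define y where "y = x * q ^ i mod n"
  have y_pos: "y > 0" using i[of 0] assms(2) by (simp add: y_def)
  have shift: "y * q ^ j mod n \<le> y" for j
    using i[of "i + j"] by (simp add: y_def mod_mult_left_eq power_add mult.assoc)
  have y_ge: "q ^ (m - 1) \<le> y"
  proof (rule ccontr)
    assume "\<not> ?thesis"
    then have "Suc y * q \<le> q ^ (m - 1) * q" by (intro mult_le_mono1) simp
    then have "y * q + q \<le> Suc n" using Suc_n q_power_m by (simp add: mult.commute)
    then have "y * q ^ 1 mod n = y * q" using q_ge by simp
    with shift[of 1] have "y * q \<le> y" by simp
    moreover have "y * 3 \<le> y * q" using q_ge by simp
    ultimately show False using y_pos by linarith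
  qed
  define r where "r = y - q ^ (m - 1)"
  have y_eq: "y = q ^ (m - 1) + r" using y_ge by (simp add: r_def)
  have r_less: "r < q ^ f" using small[of i] y_eq by (simp add: y_def)
  have "r = 0"
  proof (rule ccontr)
    assume "r \<noteq> 0"
    then obtain p where p: "q ^ p \<le> r" "r < q ^ (p + 1)"
      using ex_power_ivl1[of q r] q_ge by auto
    have "q ^ p < q ^ f" using p(1) r_less by linarith
    then have pf: "p < f" using q_ge by (simp add: power_less_imp_less_exp)
    \<comment> \<open>Here p is the position of the leading digit of r; the last bound combines
      \<open>p < f\<close> with \<open>2 * f \<le> m - 1\<close>.\<close>
    have e: "m - 1 - p = Suc (m - 2 - p)" "(m - 1) + (m - 1 - p) = m + (m - 2 - p)"
      "p + 1 + (m - 1 - p) = m" "p + (m - 1 - p) = m - 1" "f \<le> m - 2 - p"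
      using pf m_ge by auto
    \<comment> \<open>The shift \<open>v\<close> of \<open>y\<close> starts with the leading digit of \<open>r\<close>, and the leading 1 of \<open>y\<close>
      follows at a position that is still at least \<open>f\<close>.\<close>
    define v where "v = r * q ^ (m - 1 - p) + q ^ (m - 2 - p)"
    have "y * q ^ (m - 1 - p) = r * q ^ (m - 1 - p) + 1 * q ^ (m + (m - 2 - p))"
      unfolding y_eq e(2)[symmetric] power_add by (simp add: algebra_simps)
    also have "[\<dots> = v] (mod n)"
      unfolding v_def using cong_q_power_add[of 1 "m - 2 - p"] by (intro cong_add cong_refl) simp
    finally have "y * q ^ (m - 1 - p) mod n = v mod n" by (simp add: cong_def)
    moreover have "v < n"
    proof -
      have "Suc r * q ^ (m - 1 - p) \<le> q ^ (p + 1) * q ^ (m - 1 - p)"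
        using p(2) by (intro mult_le_mono1) simp
      also have "\<dots> = Suc n" using e(3) Suc_n by (metis power_add)
      finally have "q ^ (m - 1 - p) + r * q ^ (m - 1 - p) \<le> Suc n" by simp
      moreover have "3 * q ^ (m - 2 - p) \<le> q ^ (m - 1 - p)"
        unfolding e(1) by (rule q_power_Suc_ge)
      ultimately show ?thesis unfolding v_def using q_power_pos[of "m - 2 - p"] by linarith
    qed
    moreover have "v \<ge> q ^ (m - 1) + q ^ f"
    proof -
      have "q ^ p * q ^ (m - 1 - p) \<le> r * q ^ (m - 1 - p)" using p(1) by (rule mult_le_mono1)
      then have "q ^ (m - 1) \<le> r * q ^ (m - 1 - p)" using e(4) by (metis power_add)
      then show ?thesis unfolding v_def using q_power_le[OF e(5)] by linarith
    qed
    ultimately show False using shift[of "m - 1 - p"] y_eq r_less by simp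
  qed
  then have "[x * q ^ i = q ^ (m - 1)] (mod n)" using y_eq unfolding y_def cong_def by (metis add.right_neutral mod_mod_trivial)
  from cong_shift_back[OF this] show ?thesis by (metis power_add)
qed

section \<open>Size estimates and sufficiency of the bound\<close>

lemma q_power_shift_le: "q ^ i mod n \<le> q ^ (m - 1)"
proof -
  have "q ^ i mod n = q ^ (i mod m) mod n" using cong_q_power_mod[of 1 i] by (simp add: cong_def)
  also have "\<dots> \<le> q ^ (i mod m)" by simp
  also have "\<dots> \<le> q ^ (m - 1)" using m_ge by (intro q_power_le) (simp add: less_imp_le_nat Suc_leI flip: less_Suc_eq_le)
  finally show ?thesis .
qed

text \<open>Keeps the numbers below in the range of residues. The estimate is tight for
  \<open>m = 2\<close> and \<open>q = 3\<close>, where it reads 7 < 8.\<close>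

lemma q_power_sum_le: "q ^ (m - 1) + q ^ f + q < n"
proof -
  have "f \<le> m - 1 - 1" using m_ge by auto
  then have f: "q ^ f \<le> q ^ (m - 2)" by (intro q_power_le) simp
  have e: "m - 1 = Suc (m - 2)" using m_ge by simp
  have a: "3 * q ^ (m - 2) \<le> q ^ (m - 1)" unfolding e by (rule q_power_Suc_ge)
  show ?thesis
  proof (cases "m = 2")
    case True
    then have "q ^ (m - 1) + q ^ f = Suc q" by simp
    then show ?thesis using n_large(2) mult_le_mono1[OF q_ge, of q] q_ge by linarith
  next
    case False
    then have "q ^ 2 \<le> q ^ (m - 1)" using m_ge by (intro q_power_le) simp
    then have "3 * q \<le> q ^ (m - 1)"
      using mult_le_mono1[OF q_ge, of q] unfolding power2_eq_square by linarith
    then show ?thesis using n_large(1) f a q_ge by linarith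
  qed
qed

lemma n_minus_q: "(n - 1) * q mod n = n - q"
proof -
  have "q < n" using q_power_sum_le by simp
  then have "n - q + n * (q - 1) = (n - 1) * q"
    using q_ge by (simp add: algebra_simps)
  then have "(n - 1) * q mod n = (n - q) mod n" by (metis mod_mult_self2)
  then show ?thesis using \<open>q < n\<close> q_ge by simp
qed

text \<open>A shift that is neither forbidden nor below the forbidden range could only be
  \<open>n - 1\<close>, that is -1. Its next shift \<open>n - q\<close> is then forbidden by the
  size of \<delta>.\<close>

lemma dual_zeros_subset:
  assumes "2 \<le> \<delta>" "\<delta> \<le> n" "n - \<delta> \<le> q ^ (m - 1) + q ^ f" "k \<in> dual_zeros q n \<delta>"
  shows "k * q ^ i mod n < n - \<delta>"
proof (rule ccontr)
  assume "\<not> ?thesis"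
  moreover have "k * q ^ i mod n < n" using n_ge by simp
  moreover have "k * q ^ i mod n \<notin> {n - \<delta>..n - 2}" using assms(4) by (simp add: dual_zeros_def)
  ultimately have "k * q ^ i mod n = n - 1" unfolding atLeastAtMost_iff by linarith
  then have "k * q ^ Suc i mod n = n - q"
    using n_minus_q mod_mult_left_eq[of "k * q ^ i" n q] by (simp add: mult_ac)
  moreover have "k * q ^ Suc i mod n \<notin> {n - \<delta>..n - 2}" using assms(4) unfolding dual_zeros_def by blast
  moreover have "n - \<delta> \<le> n - q" using assms(3) q_power_sum_le by linarith
  ultimately show False using q_ge by simp
qed

text \<open>Only multiples of n and shifts of 1 can be dual zeros. The latter occur exactly if
  \<open>n - \<delta>\<close> exceeds their largest residue \<open>q ^ (m - 1)\<close>.\<close>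

lemma interval_if:
  assumes "2 \<le> \<delta>" "1 \<le> n - \<delta>" "n - \<delta> \<le> q ^ (m - 1) + q ^ f"
  shows "\<exists>b d. 1 \<le> b \<and> 2 \<le> d \<and> d \<le> n \<and> coset_closure q n {b..b + d - 2} = dual_zeros q n \<delta>"
proof -
  have dn: "\<delta> \<le> n" using assms(2) by simp
  have small: "k * q ^ i mod n < n - \<delta>" if "k \<in> dual_zeros q n \<delta>" for k i
    using dual_zeros_subset[OF assms(1) dn assms(3) that] .
  have zero: "k \<in> dual_zeros q n \<delta>" if "n dvd k" for k
    using that assms(2) by (auto simp: dual_zeros_def)
  have power: "\<exists>i. [k = q ^ i] (mod n)" if "k \<in> dual_zeros q n \<delta>" "\<not> n dvd k" for k
  proof (rule small_shifts_imp_q_power)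
    show "k * q ^ i mod n < q ^ (m - 1) + q ^ f" for i
      using small[OF that(1), of i] assms(3) by linarith
  qed (use that(2) in \<open>simp add: dvd_eq_mod_eq_0\<close>)
  show ?thesis
  proof (cases "n - \<delta> \<le> q ^ (m - 1)")
    case True
    have "n dvd k" if "k \<in> dual_zeros q n \<delta>" for k
    proof (rule ccontr)
      assume "\<not> n dvd k"
      then obtain i where "[k = q ^ i] (mod n)" using power \<open>k \<in> _\<close> by blast
      \<comment> \<open>The factor moves the digit 1 to the top position \<open>m - 1\<close>, where
        it is too large.\<close>
      then have "[k * q ^ ((m - 1) * i + (m - 1)) = q ^ i * q ^ ((m - 1) * i + (m - 1))] (mod n)"
        by (intro cong_mult cong_refl)
      also have "q ^ i * q ^ ((m - 1) * i + (m - 1)) = q ^ (m - 1) * q ^ (m * i)"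
        using m_ge by (cases m) (simp_all add: algebra_simps power_add)
      also have "[q ^ (m - 1) * q ^ (m * i) = q ^ (m - 1)] (mod n)" by (rule cong_q_power_mult)
      finally have "k * q ^ ((m - 1) * i + (m - 1)) mod n = q ^ (m - 1)"
        using q_power_sum_le by (simp add: cong_def)
      then show False using small[OF that] True by (metis leD)
    qed
    then have "dual_zeros q n \<delta> = {k. n dvd k}" using zero by blast
    \<comment> \<open>As b has to be positive, the residue 0 is represented by n.\<close>
    moreover have "coset_closure q n {n..n + 2 - 2} = {k. n dvd k}"
      by (auto simp: coset_closure_def cong_0_iff cong_def dvd_eq_mod_eq_0)
    ultimately show ?thesis using n_ge by (intro exI[of _ n] exI[of _ 2]) simp
  next
    case False
    have "dual_zeros q n \<delta> = {k. n dvd k \<or> (\<exists>i. [k = q ^ i] (mod n))}"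
    proof (intro equalityI subsetI)
      fix k assume "k \<in> {k. n dvd k \<or> (\<exists>i. [k = q ^ i] (mod n))}"
      then consider "n dvd k" | i where "[k = q ^ i] (mod n)" by blast
      then show "k \<in> dual_zeros q n \<delta>"
      proof cases
        case 2
        have "k * q ^ j mod n < n - \<delta>" for j
        proof -
          have "[k * q ^ j = q ^ i * q ^ j] (mod n)" using 2 by (intro cong_mult cong_refl)
          then have "k * q ^ j mod n = q ^ (i + j) mod n" by (simp add: cong_def power_add)
          then show ?thesis using q_power_shift_le[of "i + j"] False by linarith
        qed
        then show ?thesis by (simp add: dual_zeros_def not_le)
      qed (rule zero)
    qed (use power in blast)
    moreover have "coset_closure q n {n..n + 3 - 2} = {k. n dvd k \<or> (\<exists>i. [k = q ^ i] (mod n))}"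
    proof -
      have "{n..n + 3 - 2} = {n, Suc n}" by auto
      moreover have "[k = Suc n * q ^ i] (mod n) \<longleftrightarrow> [k = q ^ i] (mod n)" for k i
        by (simp add: cong_def)
      moreover have "[k = n * q ^ i] (mod n) \<longleftrightarrow> n dvd k" for k i
        by (simp add: cong_def dvd_eq_mod_eq_0)
      ultimately show ?thesis by (simp add: coset_closure_def)
    qed
    ultimately show ?thesis using n_ge by (intro exI[of _ n] exI[of _ 3]) simp
  qed
qed


section \<open>Necessity: numbers that an interval cannot avoid\<close>

definition repunit :: nat where
  "repunit = (\<Sum>i<m. q ^ i)"

text \<open>All digits are 1, so rotation fixes this number and its multiples modulo n.\<close>

lemma repunit: "(q - 1) * repunit = n" "q ^ (m - 1) < repunit" "q < repunit" "[repunit * q ^ i = repunit] (mod n)"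
proof -
  have "q * repunit + 1 = repunit + q ^ m"
  proof -
    have "(\<Sum>i<k. q ^ i) + q ^ k = q * (\<Sum>i<k. q ^ i) + 1" for k
    proof (induction k)
      case (Suc k)
      then show ?case unfolding sum.lessThan_Suc add_mult_distrib2 power_Suc by linarith
    qed simp
    then show ?thesis unfolding repunit_def by metis
  qed
  then have q: "q * repunit = repunit + n" using Suc_n by simp
  then show "(q - 1) * repunit = n" by (simp add: diff_mult_distrib)
  obtain k where k: "m = Suc (Suc k)" using m_ge by (metis add_2_eq_Suc le_Suc_ex)
  have "repunit = (\<Sum>i<k. q ^ i) + q ^ k + q ^ Suc k" unfolding repunit_def by (simp add: k)
  then show gt: "q ^ (m - 1) < repunit" using q_power_pos[of k] unfolding k by simp
  have "q ^ 1 \<le> q ^ (m - 1)" using m_ge by (intro q_power_le) simp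
  then show "q < repunit" using gt by simp
  show "[repunit * q ^ i = repunit] (mod n)"
  proof (induction i)
    case (Suc i)
    have "[repunit * q ^ i * q = repunit * q] (mod n)" using Suc by (intro cong_mult cong_refl)
    moreover have "[repunit * q = repunit] (mod n)" using q by (simp add: cong_def mult.commute)
    ultimately show ?case by (metis cong_trans mult.assoc mult.commute power_Suc)
  qed simp
qed

text \<open>If \<open>n * c\<close> precedes y, the interval passes \<open>n * d + w\<close> on the
  way up to y. If it comes later, the interval passes the excluded residue \<open>n - 2\<close> on
  the way from y to \<open>n * c\<close>.\<close>

lemma interval_contains:
  assumes c: "n * c \<in> {lo..hi}" and y: "y \<in> {lo..hi}" "w \<le> y mod n" "y mod n \<le> n - 2"
    and no: "\<And>j. j \<in> {lo..hi} \<Longrightarrow> j mod n \<noteq> n - 2"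
  shows "\<exists>j\<in>{lo..hi}. j mod n = w"
proof -
  define d where "d = y div n"
  have y_eq: "y = n * d + y mod n" by (simp add: d_def)
  show ?thesis
  proof (cases "c \<le> d")
    case True
    then have "n * c \<le> n * d" by simp
    then have "n * d + w \<in> {lo..hi}" using c y y_eq unfolding atLeastAtMost_iff by linarith
    moreover have "(n * d + w) mod n = w" using y n_ge by simp
    ultimately show ?thesis by blast
  next
    case False
    then have "n * Suc d \<le> n * c" by (intro mult_le_mono2) simp
    then have "n * d + (n - 2) \<in> {lo..hi}"
      using c y y_eq n_ge unfolding atLeastAtMost_iff mult_Suc_right by linarith
    moreover have "(n * d + (n - 2)) mod n = n - 2"
      using n_ge unfolding mod_mult_self4 by simp
    ultimately show ?thesis using no by blast
  qed
qed

text \<open>The ones of y at positions \<open>m - 1\<close> and f are spread around the cycle as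
  evenly as possible. So no rotation exceeds y, and the upper one never sinks below position
  \<open>m - 1 - f\<close>.\<close>

lemma shift_two_ones:
  defines "y \<equiv> q ^ (m - 1) + q ^ f"
  shows "y * q ^ i mod n \<le> y" "q ^ (m - 1 - f) \<le> y * q ^ i mod n"
proof -
  have y_less: "y < n" using q_power_sum_le by (simp add: y_def)
  have "\<exists>v. [y * q ^ k = v] (mod n) \<and> v \<le> y \<and> q ^ (m - 1 - f) \<le> v" if k: "k < m" for k
  proof -
    \<comment> \<open>The cases count the ones that have wrapped around: none, the upper one, or
      both.\<close>
    consider "k = 0" | "1 \<le> k" "k \<le> m - 1 - f" | "m - f \<le> k" "1 \<le> k" using k by linarith
    then show ?thesis
    proof cases
      case 1
      then show ?thesis using q_power_le[of "m - 1 - f" "m - 1"]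
        by (intro exI[of _ y]) (simp add: y_def trans_le_add1)
    next
      case 2
      have e: "m - 1 + k = m + (k - 1)" using 2 by simp
      have "y * q ^ k = q ^ (k + f) + 1 * q ^ (m + (k - 1))"
        unfolding y_def e[symmetric] by (simp add: algebra_simps power_add)
      also have "[\<dots> = q ^ (k + f) + 1 * q ^ (k - 1)] (mod n)"
        by (intro cong_add cong_refl cong_q_power_add)
      finally have "[y * q ^ k = q ^ (k + f) + q ^ (k - 1)] (mod n)" by simp
      moreover have "q ^ (k + f) \<le> q ^ (m - 1)" "q ^ (k - 1) \<le> q ^ f" "q ^ (m - 1 - f) \<le> q ^ (k + f)"
        using 2 by (auto intro!: q_power_le)
      ultimately show ?thesis unfolding y_def by (meson add_mono trans_le_add1)
    next
      case 3
      have e: "m - 1 + k = m + (k - 1)" "k + f = m + (k + f - m)" using 3 k by auto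
      have "y * q ^ k = 1 * q ^ (m + (k + f - m)) + 1 * q ^ (m + (k - 1))"
        unfolding y_def e[symmetric] by (simp add: algebra_simps power_add)
      also have "[\<dots> = 1 * q ^ (k + f - m) + 1 * q ^ (k - 1)] (mod n)"
        by (intro cong_add cong_q_power_add)
      finally have "[y * q ^ k = q ^ (k - 1) + q ^ (k + f - m)] (mod n)" by (simp add: add.commute)
      moreover have "q ^ (k - 1) \<le> q ^ (m - 1)" "q ^ (k + f - m) \<le> q ^ f" "q ^ (m - 1 - f) \<le> q ^ (k - 1)"
        using 3 k by (auto intro!: q_power_le)
      ultimately show ?thesis unfolding y_def by (meson add_mono trans_le_add1)
    qed
  qed
  then obtain v where v: "[y * q ^ (i mod m) = v] (mod n)" "v \<le> y" "q ^ (m - 1 - f) \<le> v"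
    using m_ge by (meson mod_less_divisor less_le_trans zero_less_numeral)
  have "[y * q ^ i = v] (mod n)" using cong_q_power_mod v(1) cong_trans by blast
  then have "y * q ^ i mod n = v" using v(2) y_less by (simp add: cong_def)
  with v show "y * q ^ i mod n \<le> y" "q ^ (m - 1 - f) \<le> y * q ^ i mod n" by simp_all
qed

text \<open>If the bound fails with \<open>\<delta> < n\<close>, the number y with two ones is a
  dual zero and bounds \<delta> in the case \<open>q \<le> \<delta>\<close>. With this bound z,
  whose digits are equal, is a dual zero for every such \<delta>, and the way up to z meets a
  forbidden shift.\<close>

lemma interval_only_if:
  assumes \<delta>: "2 \<le> \<delta>" "\<delta> \<le> n" and eq: "coset_closure q n {lo..hi} = dual_zeros q n \<delta>"
    and "lo \<le> hi"
  shows "1 \<le> n - \<delta> \<and> n - \<delta> \<le> q ^ (m - 1) + q ^ f"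
proof (rule ccontr)
  assume neg: "\<not> ?thesis"
  have sub: "j \<in> dual_zeros q n \<delta>" if "j \<in> {lo..hi}" for j
    using in_coset_closure[OF that] eq by simp
  have no: "w * q ^ i mod n \<notin> {n - \<delta>..n - 2}" if "j \<in> {lo..hi}" "j mod n = w" for j i w
    using sub[OF that(1)] that(2) by (auto simp: dual_zeros_def mod_mult_left_eq)
  \<comment> \<open>For \<open>\<delta> = n\<close> the shifts of a dual zero would be below 0, yet
    the interval is nonempty.\<close>
  have "n - \<delta> \<noteq> 0"
  proof
    assume "n - \<delta> = 0"
    then show False
      using dual_zeros_subset[OF \<delta>, of lo 0] sub[of lo] \<open>lo \<le> hi\<close> \<open>n - \<delta> = 0\<close> by simp
  qed
  then have N: "q ^ (m - 1) + q ^ f < n - \<delta>" using neg by linarith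
  have "0 \<in> dual_zeros q n \<delta>" using \<open>n - \<delta> \<noteq> 0\<close> by (simp add: dual_zeros_def)
  then obtain j i where j: "j \<in> {lo..hi}" "[0 = j * q ^ i] (mod n)"
    unfolding eq[symmetric] coset_closure_def by blast
  then have "[j = 0 * q ^ ((m - 1) * i)] (mod n)" by (intro cong_shift_back) (rule cong_sym)
  then have "n dvd j" by (simp add: cong_0_iff)
  then obtain c where c: "n * c \<in> {lo..hi}" using j(1) by (auto elim: dvdE)
  have no2: "j mod n \<noteq> n - 2" if "j \<in> {lo..hi}" for j
    using no[OF that refl, of 0] \<delta> by auto
  note interval = interval_contains[OF c _ _ _ no2]

  \<comment> \<open>The interval reaches some shift of \<open>y\<close>, hence contains the number with \<open>m - 1 - f\<close> final
    digits \<open>q - 1\<close>, whose shift \<open>q ^ m - q ^ (f + 1)\<close> has to avoid the forbidden range.\<close>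
  have step: "\<delta> < q ^ (f + 1)" if "q \<le> \<delta>"
  proof (rule ccontr)
    assume "\<not> ?thesis"
    define y where "y = q ^ (m - 1) + q ^ f"
    have "y \<in> dual_zeros q n \<delta>" using shift_two_ones(1) N
      unfolding dual_zeros_def y_def by (force dest: le_less_trans)
    then obtain j i where j: "j \<in> {lo..hi}" "[y = j * q ^ i] (mod n)"
      unfolding eq[symmetric] coset_closure_def by blast
    then have "[j = y * q ^ ((m - 1) * i)] (mod n)" by (intro cong_shift_back) (rule cong_sym)
    then have jm: "j mod n = y * q ^ ((m - 1) * i) mod n" by (simp add: cong_def)
    have "q ^ (m - 1 - f) - 1 \<le> j mod n" "j mod n \<le> n - 2"
      using shift_two_ones[of "(m - 1) * i"] N \<delta> unfolding jm y_def by linarith+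
    from interval[OF j(1) this] obtain k where k: "k \<in> {lo..hi}" "k mod n = q ^ (m - 1 - f) - 1" by blast
    have f: "m - 1 - f + (f + 1) = m" using m_ge by simp
    then have "(q ^ (m - 1 - f) - 1) * q ^ (f + 1) = Suc n - q ^ (f + 1)"
      by (simp only: diff_mult_distrib power_add[symmetric] Suc_n mult_1)
    moreover have "q ^ 1 \<le> q ^ (f + 1)" by (rule q_power_le) simp
    then have "3 \<le> q ^ (f + 1)" using q_ge unfolding power_one_right by linarith
    moreover from this have "Suc n - q ^ (f + 1) < n" using n_ge by linarith
    ultimately have "(q ^ (m - 1 - f) - 1) * q ^ (f + 1) mod n = Suc n - q ^ (f + 1)"
      by (metis mod_less)
    \<comment> \<open>Modulo n this is the negative of \<open>q ^ (f + 1) - 1\<close>, which lies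
      between 2 and \<delta>.\<close>
    moreover have "Suc n - q ^ (f + 1) \<in> {n - \<delta>..n - 2}"
      unfolding atLeastAtMost_iff using \<open>\<not> \<delta> < q ^ (f + 1)\<close> \<open>3 \<le> q ^ (f + 1)\<close> by linarith
    ultimately show False using no[OF k, of "f + 1"] by metis
  qed

  \<comment> \<open>\<open>z\<close> has all its digits equal to \<open>q - e\<close>, so it is its own only shift and must lie in the
    interval; \<open>w\<close> has the digits \<open>q - e - 1, q - 1, ..., q - 1\<close> and shifts to \<open>n - e\<close>.\<close>
  define e where "e = min \<delta> (q - 1)"
  \<comment> \<open>The first two bounds make \<open>n - e\<close> forbidden, the third keeps the
    digit \<open>q - e\<close> positive.\<close>
  have e: "2 \<le> e" "e \<le> \<delta>" "e < q" using \<delta> q_ge by (auto simp: e_def)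
  define z where "z = (q - e) * repunit"
  have nz: "z + (e - 1) * repunit = n"
    using e repunit(1) unfolding z_def add_mult_distrib[symmetric] by simp
  \<comment> \<open>This puts z below the forbidden range. For \<open>q \<le> \<delta>\<close> it
    rests on \<open>step\<close>; otherwise \<open>e = \<delta>\<close> and \<open>repunit\<close>
    is at least 4.\<close>
  have e_rep: "\<delta> < (e - 1) * repunit"
  proof (cases "q \<le> \<delta>")
    case True
    have "q ^ (f + 1) \<le> q ^ (m - 1)" using m_ge by (intro q_power_le) auto
    then have "\<delta> < repunit" using step[OF True] repunit(2) by linarith
    also have "\<dots> \<le> (e - 1) * repunit" using e mult_le_mono1[of 1 "e - 1" repunit] by linarith
    finally show ?thesis .
  next
    case False
    then have "e = \<delta>" by (simp add: e_def)
    have "(\<delta> - 1) * 4 \<le> (\<delta> - 1) * repunit" using repunit(3) q_ge by (intro mult_le_mono2) simp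
    then show ?thesis unfolding \<open>e = \<delta>\<close> using \<delta> by linarith
  qed
  have z_less: "z < n - \<delta>" using nz e_rep by linarith
  have zq: "[z * q ^ i = z] (mod n)" for i
    unfolding z_def using repunit(4)[of i] by (metis cong_scalar_left mult.assoc)
  then have "z * q ^ i mod n = z" for i using z_less by (simp add: cong_def)
  then have "z \<in> dual_zeros q n \<delta>" using z_less by (simp add: dual_zeros_def)
  then obtain j i where j: "j \<in> {lo..hi}" "[z = j * q ^ i] (mod n)"
    unfolding eq[symmetric] coset_closure_def by blast
  then have "[j = z * q ^ ((m - 1) * i)] (mod n)" by (intro cong_shift_back) (rule cong_sym)
  then have "[j = z] (mod n)" using zq cong_trans by blast
  then have jm: "j mod n = z" using z_less by (simp add: cong_def)
  define w where "w = (q - e) * q ^ (m - 1) - 1"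
  have "(q - e) * q ^ (m - 1) \<le> z" unfolding z_def using repunit(2) by (intro mult_le_mono2) simp
  then have "w \<le> j mod n" "j mod n \<le> n - 2" using z_less \<delta> by (auto simp: jm w_def)
  from interval[OF j(1) this] obtain k where k: "k \<in> {lo..hi}" "k mod n = w" by blast
  have "w * q + q = (q - e) * Suc n"
  proof -
    have "Suc w = (q - e) * q ^ (m - 1)" using e by (simp add: w_def)
    then have "Suc w * q = (q - e) * q ^ m" unfolding q_power_m by (simp only: mult_ac)
    then show ?thesis unfolding Suc_n mult_Suc by linarith
  qed
  moreover have "\<dots> = (q - e) * n + (q - e)" by simp
  ultimately have "w * q + e = (q - e) * n" using e by linarith
  moreover have "(q - e) * n = (q - e - 1) * n + n" using e by (cases "q - e") simp_all
  moreover have "e < n" using e q_power_sum_le by linarith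
  ultimately have "w * q = (q - e - 1) * n + (n - e)" by linarith
  then have "w * q ^ 1 mod n = n - e"
    unfolding power_one_right using e \<open>e < n\<close> by (simp only: mod_mult_self3) simp
  then show False using no[OF k, of 1] e by (simp add: diff_le_mono2)
qed

theorem dual_zeros_interval_iff:
  assumes "2 \<le> \<delta>" "\<delta> \<le> n"
  shows "(\<exists>b d. 1 \<le> b \<and> 2 \<le> d \<and> d \<le> n \<and> coset_closure q n {b..b + d - 2} = dual_zeros q n \<delta>) \<longleftrightarrow>
    1 \<le> n - \<delta> \<and> n - \<delta> \<le> q ^ (m - 1) + q ^ f"
  using interval_if[of \<delta>] interval_only_if[of \<delta>] assms by fastforce

end

section \<open>Codes given by their zeros\<close>

text \<open>Multiplication by a nonzero x permutes the units, and their product cancels.\<close>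

lemma finite_field_power_card:
  fixes x :: "'a::{field,finite}"
  shows "x ^ CARD('a) = x"
proof (cases "x = 0")
  case False
  have "(\<Prod>y\<in>UNIV - {0}. x * y) = (\<Prod>y\<in>UNIV - {0}. y)"
    using False by (intro prod.reindex_bij_witness[of _ "\<lambda>y. y / x" "\<lambda>y. x * y"]) auto
  then have "x ^ card (UNIV - {0 :: 'a}) = 1" by (simp add: prod.distrib)
  moreover have "CARD('a) = Suc (card (UNIV - {0 :: 'a}))"
    by (rule card.remove) simp_all
  ultimately show ?thesis by (metis power_Suc mult_1_right)
qed simp

text \<open>Linear independence of the Frobenius powers: the polynomial has degree below
  \<open>q ^ m\<close> but every field element as a root.\<close>

lemma linearized_poly_vanishing:
  fixes a :: "nat \<Rightarrow> 'a::{field,finite}"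
  assumes "CARD('a) = q ^ m" "1 < q" "\<And>x. (\<Sum>t<m. a t * x ^ (q ^ t)) = 0" "t < m"
  shows "a t = 0"
proof -
  define P where "P = (\<Sum>t<m. Polynomial.monom (a t) (q ^ t))"
  have "P = 0"
  proof (rule ccontr)
    assume "P \<noteq> 0"
    have "degree P \<le> q ^ (m - 1)"
      unfolding P_def using assms(2)
      by (intro degree_sum_le) (auto intro!: order_trans[OF degree_monom_le] power_increasing)
    also have "\<dots> < q ^ m" using assms(2,4) by (intro power_strict_increasing) auto
    finally have "degree P < CARD('a)" using assms(1) by simp
    moreover have "{x. poly P x = 0} = UNIV"
      using assms(3) by (simp add: P_def poly_sum poly_monom)
    ultimately show False using card_poly_roots_bound[OF \<open>P \<noteq> 0\<close>] by simp
  qed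
  moreover have "poly.coeff P (q ^ t) = (\<Sum>s<m. if s = t then a s else 0)"
    unfolding P_def coeff_sum using assms(2) by (intro sum.cong) auto
  ultimately show ?thesis using assms(4) by simp
qed

locale primitive_root_setting =
  field_hom h for h :: "'f::{field_gcd,finite} \<Rightarrow> 'e::{field,finite}" +
  fixes \<alpha> :: 'e and q m n :: nat
  assumes card_f: "CARD('f) = q" and card_e: "CARD('e) = q ^ m"
    and units: "UNIV - {0} = range (\<lambda>k::nat. \<alpha> ^ k)"
    and primepow_q: "primepow q" and q_3: "q \<ge> 3" and m_2: "m \<ge> 2" and n_def: "n = q ^ m - 1"
begin

sublocale cyclic_shift q m n
  using q_3 m_2 n_def by unfold_locales

abbreviation eval :: "'f poly \<Rightarrow> 'e \<Rightarrow> 'e" where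
  "eval c x \<equiv> poly (map_poly h c) x"

section \<open>The primitive element and the Frobenius map\<close>

lemma alpha_nonzero [simp]: "\<alpha> \<noteq> 0"
proof -
  have "\<alpha> ^ 1 \<in> UNIV - {0}" unfolding units by blast
  then show ?thesis by simp
qed

lemma alpha_n: "\<alpha> ^ n = 1"
proof -
  have "\<alpha> * \<alpha> ^ n = \<alpha> * 1"
    using finite_field_power_card[of \<alpha>] unfolding card_e Suc_n power_Suc by simp
  then show ?thesis by simp
qed

lemma alpha_mod: "\<alpha> ^ (k mod n) = \<alpha> ^ k"
proof -
  have "\<alpha> ^ k = \<alpha> ^ (n * (k div n) + k mod n)" by simp
  also have "\<dots> = \<alpha> ^ (k mod n)" unfolding power_add power_mult alpha_n by simp
  finally show ?thesis by simp
qed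

lemma alpha_cong: "[j = k] (mod n) \<Longrightarrow> \<alpha> ^ j = \<alpha> ^ k"
  unfolding cong_def by (metis alpha_mod)

lemma alpha_eq_1_iff: "\<alpha> ^ k = 1 \<longleftrightarrow> n dvd k"
proof
  assume "\<alpha> ^ k = 1"
  define d where "d = k mod n"
  have d: "\<alpha> ^ d = 1" using \<open>\<alpha> ^ k = 1\<close> by (simp add: d_def alpha_mod)
  have "d = 0"
  proof (rule ccontr)
    assume "d \<noteq> 0"
    have "range (\<lambda>k::nat. \<alpha> ^ k) \<subseteq> (\<lambda>k. \<alpha> ^ k) ` {..<d}"
    proof clarify
      fix j
      have "\<alpha> ^ j = \<alpha> ^ (d * (j div d) + j mod d)" by simp
      also have "\<dots> = \<alpha> ^ (j mod d)" unfolding power_add power_mult d by simp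
      finally show "\<alpha> ^ j \<in> (\<lambda>k. \<alpha> ^ k) ` {..<d}" using \<open>d \<noteq> 0\<close> by auto
    qed
    then have "card (UNIV - {0 :: 'e}) \<le> card {..<d}"
      unfolding units by (meson card_image_le card_mono finite_imageI finite_lessThan le_trans)
    moreover have "card (UNIV - {0 :: 'e}) = n" using card_e Suc_n by (simp add: card_Diff_singleton)
    moreover have "d < n" using n_ge by (simp add: d_def)
    ultimately show False by simp
  qed
  then show "n dvd k" by (simp add: d_def dvd_eq_mod_eq_0)
qed (auto simp: power_mult alpha_n)

text \<open>The characteristic divides \<open>q ^ m\<close>, hence is the prime underlying q. This
  makes q-th powers additive.\<close>

lemma q_eq_CHAR_power: "\<exists>k. q = CHAR('e) ^ k" and prime_CHAR: "prime CHAR('e)"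
proof -
  show p: "prime CHAR('e)" by (rule prime_CHAR_semidom) (simp add: finite_imp_CHAR_pos)
  have "CHAR('e) dvd q ^ m" using CHAR_dvd_CARD[where 'a = 'e] card_e by simp
  then have "CHAR('e) dvd q" using p by (simp add: prime_dvd_power)
  moreover obtain r k where "prime r" "q = r ^ k" using primepow_q by (auto simp: primepow_def)
  ultimately show "\<exists>k. q = CHAR('e) ^ k"
    using p by (metis prime_dvd_power primes_dvd_imp_eq)
qed

lemma sum_power_q: "(\<Sum>i\<in>A. g i :: 'e) ^ q = (\<Sum>i\<in>A. g i ^ q)"
  using q_eq_CHAR_power prime_CHAR freshmans_dream_sum' by metis

lemma sum_power_q_power: "(\<Sum>i\<in>A. g i :: 'e) ^ (q ^ t) = (\<Sum>i\<in>A. g i ^ (q ^ t))"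
proof (induction t)
  case (Suc t)
  have "(\<Sum>i\<in>A. g i) ^ (q ^ Suc t) = ((\<Sum>i\<in>A. g i) ^ (q ^ t)) ^ q"
    by (simp only: power_Suc2 power_mult)
  then show ?case by (simp only: Suc sum_power_q power_Suc2 power_mult)
qed simp

lemma of_nat_n: "of_nat n = (- 1 :: 'e)"
proof -
  have "of_nat (Suc n) = (0 :: 'e)"
    using CHAR_dvd_CARD[where 'a = 'e] card_e Suc_n by (simp only: of_nat_eq_0_iff_char_dvd)
  then have "of_nat n + 1 = (0 :: 'e)" by (simp add: add.commute)
  then show ?thesis by (simp only: eq_neg_iff_add_eq_0)
qed

text \<open>Orthogonality by the geometric sum; the value -1 is n itself read in the field, where
  \<open>q ^ m\<close> is 0.\<close>

lemma sum_powers_alpha: "(\<Sum>i<n. (\<alpha> ^ k) ^ i) = (if n dvd k then - 1 else 0)"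
proof (cases "n dvd k")
  case True
  then show ?thesis using of_nat_n by (simp add: alpha_eq_1_iff[THEN iffD2])
next
  case False
  have "(\<alpha> ^ k) ^ n = 1" by (metis alpha_n mult.commute power_mult power_one)
  then have "(\<alpha> ^ k - 1) * (\<Sum>i<n. (\<alpha> ^ k) ^ i) = 0" using power_diff_1_eq[of "\<alpha> ^ k" n] by simp
  then show ?thesis using False alpha_eq_1_iff by simp
qed

lemma h_eq_0_iff: "h x = 0 \<longleftrightarrow> x = 0"
  by (metis hom_mult hom_one hom_zero mult_zero_left right_inverse zero_neq_one)

lemma inj_h: "inj h"
proof (rule injI)
  fix x y assume "h x = h y"
  then have "h (x - y) = 0" by (simp add: hom_minus)
  then show "x = y" by (simp add: h_eq_0_iff)
qed

lemma h_power_q: "h x ^ q = h x"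
  using finite_field_power_card[of x] card_f by (metis hom_power)

text \<open>The image of \<open>h\<close> already supplies q roots of \<open>x ^ q - x\<close>,
  which has no more.\<close>

lemma range_h: "range h = {z. z ^ q = z}"
proof (rule card_seteq)
  define P :: "'e poly" where "P = Polynomial.monom 1 q - Polynomial.monom 1 1"
  have "poly.coeff P q = 1" using q_3 by (simp add: P_def)
  then have "P \<noteq> 0" by auto
  have "degree P \<le> q" unfolding P_def using q_3 by (intro degree_diff_le) (auto intro: order_trans[OF degree_monom_le])
  have eq: "{z. z ^ q = z} = {z. poly P z = 0}" by (simp add: P_def poly_monom)
  have "card (range h) = q" using card_f by (simp add: card_image inj_h)
  then show "card {z :: 'e. z ^ q = z} \<le> card (range h)"
    using card_poly_roots_bound[OF \<open>P \<noteq> 0\<close>] \<open>degree P \<le> q\<close> unfolding eq by linarith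
qed (auto simp: h_power_q)

section \<open>Evaluation, minimal polynomials and codes\<close>

lemma eval_eq_sum:
  assumes "degree c < n"
  shows "eval c x = (\<Sum>i<n. h (poly.coeff c i) * x ^ i)"
proof -
  have "degree (map_poly h c) < n" using degree_map_poly_le[of h c] assms by linarith
  then have "eval c x = (\<Sum>i<n. poly.coeff (map_poly h c) i * x ^ i)"
    unfolding poly_altdef by (intro sum.mono_neutral_left) (auto simp: coeff_eq_0)
  then show ?thesis by (simp add: coeff_map_poly)
qed

lemma eval_mult: "eval (p * r) x = eval p x * eval r x"
proof -
  interpret map_poly_hom: map_poly_idom_hom h ..
  show ?thesis by (simp add: map_poly_hom.hom_mult)
qed

text \<open>Frobenius powers are additive and fix the coefficients, so zeros come in whole
  cyclotomic cosets.\<close>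

lemma eval_power_q:
  assumes "degree c < n"
  shows "eval c (x ^ (q ^ t)) = eval c x ^ (q ^ t)"
proof -
  have h: "h y ^ (q ^ t) = h y" for y
    by (induction t) (simp_all add: power_mult h_power_q)
  show ?thesis
    unfolding eval_eq_sum[OF assms] sum_power_q_power power_mult_distrib h
    by (intro sum.cong refl arg_cong2[where f = "(*)"]) (metis mult.commute power_mult)
qed

text \<open>A monic polynomial of least degree vanishing at x exists and is unique, which justifies
  the \<open>THE\<close>; division with remainder does the rest.\<close>

lemma min_poly_dvd_iff: "min_poly h x dvd p \<longleftrightarrow> eval p x = 0"
proof -
  define least where "least p \<longleftrightarrow> lead_coeff p = 1 \<and> eval p x = 0 \<and>
     (\<forall>p'. p' \<noteq> 0 \<and> eval p' x = 0 \<longrightarrow> degree p \<le> degree p')" for p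
  have "\<exists>p0. p0 \<noteq> 0 \<and> eval p0 x = 0"
  proof (intro exI conjI)
    \<comment> \<open>With \<open>Suc n = q ^ m\<close> this polynomial vanishes on the whole large
      field.\<close>
    define P :: "'f poly" where "P = Polynomial.monom 1 (Suc n) - Polynomial.monom 1 1"
    have "poly.coeff P (Suc n) = 1" using n_ge by (simp add: P_def)
    then show "P \<noteq> 0" by auto
    have "map_poly h P = Polynomial.monom 1 (Suc n) - Polynomial.monom 1 1"
      by (rule poly_eqI) (simp add: P_def coeff_map_poly hom_minus)
    then show "eval P x = 0"
      using finite_field_power_card[of x] unfolding card_e Suc_n by (simp add: poly_monom)
  qed
  then obtain p1 where p1: "p1 \<noteq> 0" "eval p1 x = 0" "\<And>p'. p' \<noteq> 0 \<Longrightarrow> eval p' x = 0 \<Longrightarrow> degree p1 \<le> degree p'"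
    using ex_has_least_nat[of "\<lambda>p. p \<noteq> 0 \<and> eval p x = 0" _ degree] by blast
  have "least (smult (inverse (lead_coeff p1)) p1)"
    using p1 by (simp add: least_def map_poly_hom_smult)
  moreover have "p = p'" if "least p" "least p'" for p p'
  proof (rule ccontr)
    assume "p \<noteq> p'"
    have ne: "p \<noteq> 0" "p' \<noteq> 0" using that by (auto simp: least_def)
    then have deg: "degree p = degree p'" using that unfolding least_def by (meson le_antisym)
    have "map_poly h (p - p') = map_poly h p - map_poly h p'"
      by (rule poly_eqI) (simp add: coeff_map_poly hom_minus)
    then have "degree p \<le> degree (p - p')" using that \<open>p \<noteq> p'\<close> by (simp add: least_def)
    moreover have "degree (p - p') \<le> degree p" using deg by (simp add: degree_diff_le)
    ultimately have "lead_coeff (p - p') = 0" using that deg by (simp add: least_def)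
    then show False using \<open>p \<noteq> p'\<close> by (metis eq_iff_diff_eq_0 leading_coeff_0_iff)
  qed
  ultimately have "\<exists>!p. least p" by blast
  moreover have "min_poly h x = (THE p. least p)" by (simp add: min_poly_def least_def)
  ultimately have least: "least (min_poly h x)" by (metis theI')
  show ?thesis
  proof
    assume "min_poly h x dvd p"
    then show "eval p x = 0" using least by (auto simp: least_def eval_mult)
  next
    assume "eval p x = 0"
    define M where "M = min_poly h x"
    have "M \<noteq> 0" "eval M x = 0" using least by (auto simp: least_def M_def)
    have "map_poly h p = map_poly h (M * (p div M) + p mod M)" by simp
    then have "eval p x = eval (M * (p div M)) x + eval (p mod M) x" by (metis map_poly_hom_add poly_add)
    moreover have "eval (M * (p div M)) x = 0" using \<open>eval M x = 0\<close> by (simp add: eval_mult)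
    ultimately have "eval (p mod M) x = 0" using \<open>eval p x = 0\<close> by simp
    then have "p mod M = 0" using least degree_mod_less[OF \<open>M \<noteq> 0\<close>, of p]
      unfolding least_def M_def by (metis leD)
    then show "min_poly h x dvd p" by (simp add: M_def mod_eq_0_iff_dvd)
  qed
qed

definition zeros_code :: "nat set \<Rightarrow> 'f poly set" where
  "zeros_code S = {c. degree c < n \<and> (\<forall>j\<in>S. eval c (\<alpha> ^ j) = 0)}"

text \<open>The generator divides exactly the polynomials vanishing at the listed powers. It divides
  \<open>x ^ n - 1\<close> as well, so reduction preserves divisibility by it.\<close>

lemma bch_code_eq: "bch_code h \<alpha> n \<delta> b = zeros_code {b..b + \<delta> - 2}"
proof -
  define g where "g = Lcm ((\<lambda>j. min_poly h (\<alpha> ^ j)) ` {b..b + \<delta> - 2})"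
  have g: "g dvd p \<longleftrightarrow> (\<forall>j\<in>{b..b + \<delta> - 2}. eval p (\<alpha> ^ j) = 0)" for p
    unfolding g_def Lcm_dvd_iff by (simp add: min_poly_dvd_iff)
  define M :: "'f poly" where "M = Polynomial.monom 1 n - 1"
  have "poly.coeff M n = 1" using n_ge by (simp add: M_def)
  then have "M \<noteq> 0" by auto
  have "degree M \<le> n" unfolding M_def by (intro degree_diff_le) (auto intro: degree_monom_le)
  then have deg: "degree M = n" using \<open>poly.coeff M n = 1\<close> by (intro antisym le_degree) auto
  have "map_poly h M = Polynomial.monom 1 n - 1"
    by (rule poly_eqI) (simp add: M_def coeff_map_poly hom_minus)
  moreover have "(\<alpha> ^ j) ^ n = 1" for j by (metis alpha_n mult.commute power_mult power_one)
  ultimately have "eval M (\<alpha> ^ j) = 0" for j by (simp add: poly_monom)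
  then have "g dvd M" using g by blast
  have "bch_code h \<alpha> n \<delta> b = {c. degree c < n \<and> g dvd c}"
    unfolding bch_code_def cyclic_code_def g_def[symmetric] M_def[symmetric]
  proof (intro equalityI subsetI)
    fix c assume "c \<in> range (\<lambda>f. f * g mod M)"
    then obtain f where c: "c = f * g mod M" by blast
    have "g dvd c" unfolding c using \<open>g dvd M\<close> by (simp add: dvd_mod)
    moreover have "degree c < n"
      using degree_mod_less[OF \<open>M \<noteq> 0\<close>, of "f * g"] deg n_ge by (auto simp: c)
    ultimately show "c \<in> {c. degree c < n \<and> g dvd c}" by simp
  next
    fix c assume "c \<in> {c. degree c < n \<and> g dvd c}"
    then obtain f where "c = g * f" "degree c < n" by blast
    then have "c = f * g mod M" using deg by (simp add: mod_poly_less mult.commute)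
    then show "c \<in> range (\<lambda>f. f * g mod M)" by blast
  qed
  then show ?thesis by (simp add: g zeros_code_def)
qed

section \<open>Traces and trace words\<close>

definition trace :: "'e \<Rightarrow> 'e" where
  "trace y = (\<Sum>t<m. y ^ (q ^ t))"

text \<open>Since \<open>y ^ (q ^ m) = y\<close>, taking q-th powers rotates the summands, so the
  trace is fixed by Frobenius.\<close>

lemma trace_in_range: "trace y \<in> range h"
proof -
  have "trace y ^ q + y ^ (q ^ 0) = (\<Sum>t<m. y ^ (q ^ Suc t)) + y ^ (q ^ 0)"
    unfolding trace_def sum_power_q by (simp only: power_Suc2 power_mult)
  also have "\<dots> = (\<Sum>t<Suc m. y ^ (q ^ t))" by (simp only: sum.lessThan_Suc_shift add.commute)
  also have "\<dots> = trace y + y ^ (q ^ 0)"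
    using finite_field_power_card[of y] card_e by (simp add: trace_def)
  finally show ?thesis unfolding range_h by simp
qed

text \<open>In \<beta> this is a linearized polynomial whose coefficient at \<open>t = 0\<close> is
  y.\<close>

lemma trace_nondegenerate:
  assumes "\<And>\<beta>. trace (\<beta> * y) = 0"
  shows "y = 0"
proof -
  have "y ^ (q ^ 0) = 0"
    using assms by (intro linearized_poly_vanishing[OF card_e, of "\<lambda>t. y ^ (q ^ t)"])
      (use q_3 m_2 in \<open>simp_all add: trace_def power_mult_distrib mult.commute\<close>)
  then show ?thesis by simp
qed

text \<open>For fixed k this is the trace description of an irreducible cyclic code; inverting
  \<open>h\<close> returns the traces to the small field.\<close>

definition trace_word :: "'e \<Rightarrow> nat \<Rightarrow> 'f poly" where
  "trace_word \<beta> k = (\<Sum>i<n. Polynomial.monom (inv_into UNIV h (trace (\<beta> * \<alpha> ^ (i * k)))) i)"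

lemma degree_trace_word: "degree (trace_word \<beta> k) < n"
proof -
  have "degree (trace_word \<beta> k) \<le> n - 1"
    unfolding trace_word_def by (intro degree_sum_le) (auto intro!: order_trans[OF degree_monom_le])
  then show ?thesis using n_ge by simp
qed

lemma coeff_trace_word:
  assumes "i < n"
  shows "h (poly.coeff (trace_word \<beta> k) i) = trace (\<beta> * \<alpha> ^ (i * k))"
proof -
  have "poly.coeff (trace_word \<beta> k) i = inv_into UNIV h (trace (\<beta> * \<alpha> ^ (i * k)))"
    using assms by (simp add: trace_word_def coeff_sum coeff_monom if_distrib sum.delta cong: if_cong)
  then show ?thesis using trace_in_range by (simp add: f_inv_into_f)
qed

text \<open>By orthogonality only those t survive for which \<open>k * q ^ t\<close> is -l modulo
  n.\<close>

lemma eval_trace_word: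
  "eval (trace_word \<beta> k) (\<alpha> ^ l) = (\<Sum>t<m. (if n dvd k * q ^ t + l then - 1 else 0) * \<beta> ^ (q ^ t))"
proof -
  have "eval (trace_word \<beta> k) (\<alpha> ^ l) = (\<Sum>i<n. trace (\<beta> * \<alpha> ^ (i * k)) * (\<alpha> ^ l) ^ i)"
    by (simp add: eval_eq_sum[OF degree_trace_word] coeff_trace_word)
  also have "\<dots> = (\<Sum>i<n. \<Sum>t<m. (\<alpha> ^ (k * q ^ t + l)) ^ i * \<beta> ^ (q ^ t))"
    unfolding trace_def sum_distrib_right
    by (simp add: power_mult_distrib power_add mult_ac flip: power_mult)
  also have "\<dots> = (\<Sum>t<m. (\<Sum>i<n. (\<alpha> ^ (k * q ^ t + l)) ^ i) * \<beta> ^ (q ^ t))"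
    unfolding sum_distrib_right by (rule sum.swap)
  finally show ?thesis unfolding sum_powers_alpha .
qed

text \<open>Summing over the positions turns the conjugates in the trace into conjugates of one
  value of d, so orthogonality for all \<beta> detects a zero.\<close>

lemma pairing_trace_word:
  assumes "degree d < n"
  shows "h (\<Sum>i<n. poly.coeff (trace_word \<beta> k) i * poly.coeff d i) = trace (\<beta> * eval d (\<alpha> ^ k))"
proof -
  have "h (\<Sum>i<n. poly.coeff (trace_word \<beta> k) i * poly.coeff d i) =
      (\<Sum>i<n. trace (\<beta> * \<alpha> ^ (i * k)) * h (poly.coeff d i))"
    by (simp add: hom_sum hom_mult coeff_trace_word)
  also have "\<dots> = (\<Sum>i<n. \<Sum>t<m. \<beta> ^ (q ^ t) * (h (poly.coeff d i) * ((\<alpha> ^ k) ^ (q ^ t)) ^ i))"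
    unfolding trace_def sum_distrib_right
    by (simp add: power_mult_distrib mult_ac flip: power_mult)
  also have "\<dots> = (\<Sum>t<m. \<beta> ^ (q ^ t) * eval d ((\<alpha> ^ k) ^ (q ^ t)))"
    unfolding eval_eq_sum[OF assms] sum_distrib_left by (rule sum.swap)
  finally show ?thesis by (simp only: eval_power_q[OF assms] trace_def power_mult_distrib)
qed

section \<open>Duality\<close>

definition annihilator :: "nat set \<Rightarrow> nat set" where
  "annihilator S = {k. \<forall>i. \<forall>j\<in>S. \<not> n dvd k * q ^ i + j}"

lemma trace_word_in_zeros_code: "k \<in> annihilator S \<Longrightarrow> trace_word \<beta> k \<in> zeros_code S"
  by (simp add: zeros_code_def degree_trace_word annihilator_def eval_trace_word)

text \<open>Among natural exponents \<open>(n - 1) * a\<close> stands for -a. In these terms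
  \<open>annihilator S\<close> holds the k for which -k avoids the closure of S.\<close>

lemma dvd_negative_iff: "n dvd (n - 1) * a + b \<longleftrightarrow> [b = a] (mod n)"
proof -
  have "(n - 1) * a + a = n * a" using n_ge by (simp add: diff_mult_distrib)
  then have "n dvd (n - 1) * a + b \<longleftrightarrow> [(n - 1) * a + b = (n - 1) * a + a] (mod n)"
    by (simp add: cong_def dvd_eq_mod_eq_0)
  then show ?thesis by (simp add: cong_add_lcancel_nat)
qed

text \<open>After expansion into coefficients, the sum over j vanishes unless \<open>i = l\<close>;
  the sign is n read in the field.\<close>

lemma parseval:
  assumes "degree c < n" "degree d < n"
  shows "(\<Sum>j<n. eval c (\<alpha> ^ j) * eval d (\<alpha> ^ ((n - 1) * j))) =
    - h (\<Sum>i<n. poly.coeff c i * poly.coeff d i)"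
proof -
  let ?c = "\<lambda>i. h (poly.coeff c i)" and ?d = "\<lambda>i. h (poly.coeff d i)"
  have "(\<Sum>j<n. eval c (\<alpha> ^ j) * eval d (\<alpha> ^ ((n - 1) * j))) =
      (\<Sum>j<n. \<Sum>i<n. \<Sum>l<n. ?c i * ?d l * (\<alpha> ^ ((n - 1) * l + i)) ^ j)"
    unfolding eval_eq_sum[OF assms(1)] eval_eq_sum[OF assms(2)] sum_product
    by (simp add: power_add power_mult_distrib mult_ac flip: power_mult)
  also have "\<dots> = (\<Sum>i<n. \<Sum>l<n. \<Sum>j<n. ?c i * ?d l * (\<alpha> ^ ((n - 1) * l + i)) ^ j)"
    by (subst sum.swap) (intro sum.cong refl sum.swap)
  also have "\<dots> = (\<Sum>i<n. \<Sum>l<n. if i = l then - (?c i * ?d l) else 0)"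
  proof (intro sum.cong refl)
    fix i l assume "i \<in> {..<n}" "l \<in> {..<n}"
    then have "n dvd (n - 1) * l + i \<longleftrightarrow> i = l"
      unfolding dvd_negative_iff by (simp add: cong_def)
    then show "(\<Sum>j<n. ?c i * ?d l * (\<alpha> ^ ((n - 1) * l + i)) ^ j) = (if i = l then - (?c i * ?d l) else 0)"
      unfolding sum_distrib_left[symmetric] sum_powers_alpha by simp
  qed
  also have "\<dots> = - h (\<Sum>i<n. poly.coeff c i * poly.coeff d i)"
    by (simp add: hom_sum hom_mult sum_negf)
  finally show ?thesis .
qed

text \<open>One inclusion tests d against trace words; for the other every term of the Parseval sum
  vanishes.\<close>

lemma dual_zeros_code: "dual_code n (zeros_code S) = zeros_code (annihilator S)"
proof (intro equalityI subsetI)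
  fix d assume "d \<in> dual_code n (zeros_code S)"
  then have d: "degree d < n" "\<And>c. c \<in> zeros_code S \<Longrightarrow> (\<Sum>i<n. poly.coeff c i * poly.coeff d i) = 0"
    by (auto simp: dual_code_def)
  have "eval d (\<alpha> ^ k) = 0" if "k \<in> annihilator S" for k
  proof (rule trace_nondegenerate)
    show "trace (\<beta> * eval d (\<alpha> ^ k)) = 0" for \<beta>
      unfolding pairing_trace_word[OF d(1), symmetric] d(2)[OF trace_word_in_zeros_code[OF that]] by simp
  qed
  with d(1) show "d \<in> zeros_code (annihilator S)" by (simp add: zeros_code_def)
next
  fix d assume "d \<in> zeros_code (annihilator S)"
  then have d: "degree d < n" "\<And>k. k \<in> annihilator S \<Longrightarrow> eval d (\<alpha> ^ k) = 0"
    by (auto simp: zeros_code_def)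
  have "(\<Sum>i<n. poly.coeff c i * poly.coeff d i) = 0" if "c \<in> zeros_code S" for c
  proof -
    have c: "degree c < n" "\<And>j. j \<in> S \<Longrightarrow> eval c (\<alpha> ^ j) = 0"
      using that by (auto simp: zeros_code_def)
    have "eval c (\<alpha> ^ j) * eval d (\<alpha> ^ ((n - 1) * j)) = 0" for j
    proof (cases "(n - 1) * j \<in> annihilator S")
      \<comment> \<open>Some shift of j is congruent to an element of S, so c itself vanishes at
        \<open>\<alpha> ^ j\<close>.\<close>
      case False
      then obtain i s where "s \<in> S" "n dvd (n - 1) * (j * q ^ i) + s"
        by (auto simp: annihilator_def mult.assoc)
      then have "\<alpha> ^ s = (\<alpha> ^ j) ^ (q ^ i)" unfolding dvd_negative_iff
        by (simp add: alpha_cong flip: power_mult)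
      then have "eval c (\<alpha> ^ j) ^ (q ^ i) = 0" using c(2)[OF \<open>s \<in> S\<close>] eval_power_q[OF c(1)] by simp
      then show ?thesis by simp
    qed (simp add: d(2))
    then have "(\<Sum>j<n. eval c (\<alpha> ^ j) * eval d (\<alpha> ^ ((n - 1) * j))) = 0"
      by (intro sum.neutral) blast
    then have "h (\<Sum>i<n. poly.coeff c i * poly.coeff d i) = 0"
      unfolding parseval[OF c(1) d(1)] by simp
    then show ?thesis by (simp add: h_eq_0_iff)
  qed
  with d(1) show "d \<in> dual_code n (zeros_code S)" by (simp add: dual_code_def)
qed

section \<open>Recovering closed zero sets from codes\<close>

lemma coset_closure_annihilator: "coset_closure q n (annihilator S) = annihilator S"
proof (intro equalityI subsetI)
  fix k assume "k \<in> coset_closure q n (annihilator S)"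
  then obtain j i where j: "j \<in> annihilator S" "[k = j * q ^ i] (mod n)"
    by (auto simp: coset_closure_def)
  have "\<not> n dvd k * q ^ t + s" if "s \<in> S" for t s
  proof -
    have "[k * q ^ t + s = j * q ^ i * q ^ t + s] (mod n)" using j(2) by (intro cong_add cong_mult cong_refl)
    then have "n dvd k * q ^ t + s \<longleftrightarrow> n dvd j * q ^ (i + t) + s"
      unfolding power_add mult.assoc[symmetric] by (rule cong_dvd_iff)
    then show ?thesis using j(1) that by (simp add: annihilator_def)
  qed
  then show "k \<in> annihilator S" by (simp add: annihilator_def)
qed (rule in_coset_closure)

lemma zeros_code_coset_closure: "zeros_code (coset_closure q n S) = zeros_code S"
proof (intro equalityI subsetI)
  fix c assume c: "c \<in> zeros_code S"
  have "eval c (\<alpha> ^ k) = 0" if "k \<in> coset_closure q n S" for k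
  proof -
    from that obtain j i where j: "j \<in> S" "[k = j * q ^ i] (mod n)" by (auto simp: coset_closure_def)
    have "eval c ((\<alpha> ^ j) ^ (q ^ i)) = 0" using c j(1) q_3 by (simp add: zeros_code_def eval_power_q)
    then show ?thesis using alpha_cong[OF j(2)] by (simp add: power_mult)
  qed
  with c show "c \<in> zeros_code (coset_closure q n S)" by (simp add: zeros_code_def)
qed (auto simp: zeros_code_def in_coset_closure)

text \<open>For k in \<open>S'\<close> outside the closure of S, all trace words of -k lie in the
  smaller code, hence vanish at \<open>\<alpha> ^ k\<close>. But their values there form a nonzero
  linearized polynomial in \<beta>.\<close>

lemma zeros_code_subset_imp:
  assumes "zeros_code S \<subseteq> zeros_code S'"
  shows "S' \<subseteq> coset_closure q n S"
proof (rule subsetI, rule ccontr)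
  fix k assume k: "k \<in> S'" "k \<notin> coset_closure q n S"
  have "(n - 1) * k \<in> annihilator S"
  proof -
    have "\<not> n dvd (n - 1) * (k * q ^ t) + j" if "j \<in> S" for t j
    proof
      assume "n dvd (n - 1) * (k * q ^ t) + j"
      then have "[k * q ^ t = j] (mod n)" unfolding dvd_negative_iff by (rule cong_sym)
      from cong_shift_back[OF this] have "k \<in> coset_closure q n S" using that by (auto simp: coset_closure_def)
      with k(2) show False by simp
    qed
    then show ?thesis by (simp add: annihilator_def mult.assoc)
  qed
  then have "trace_word \<beta> ((n - 1) * k) \<in> zeros_code S'" for \<beta>
    using trace_word_in_zeros_code assms by blast
  then have "eval (trace_word \<beta> ((n - 1) * k)) (\<alpha> ^ k) = 0" for \<beta>
    using k(1) by (simp add: zeros_code_def)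
  \<comment> \<open>The coefficient at \<open>t = 0\<close> is -1, as k and its negative add up to a
    multiple of n.\<close>
  then have "(if n dvd (n - 1) * k * q ^ 0 + k then - 1 else 0 :: 'e) = 0"
    unfolding eval_trace_word
    by (intro linearized_poly_vanishing[OF card_e, of "\<lambda>t. if n dvd (n - 1) * k * q ^ t + k then - 1 else 0"])
      (use q_3 m_2 in simp_all)
  then show False using dvd_negative_iff[of k k] by simp
qed

lemma zeros_code_eq_iff: "zeros_code S = zeros_code S' \<longleftrightarrow> coset_closure q n S = coset_closure q n S'"
proof
  assume eq: "zeros_code S = zeros_code S'"
  then show "coset_closure q n S = coset_closure q n S'"
    using zeros_code_subset_imp[of S "coset_closure q n S'"]
      zeros_code_subset_imp[of S' "coset_closure q n S"]
    unfolding zeros_code_coset_closure by blast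
next
  assume "coset_closure q n S = coset_closure q n S'"
  then show "zeros_code S = zeros_code S'"
    using zeros_code_coset_closure[of S] zeros_code_coset_closure[of S'] by simp
qed

lemma annihilator_interval:
  assumes "\<delta> \<le> n"
  shows "annihilator {2..\<delta>} = dual_zeros q n \<delta>"
proof -
  have "(\<exists>s\<in>{2..\<delta>}. n dvd r + s) \<longleftrightarrow> r mod n \<in> {n - \<delta>..n - 2}" for r
  proof
    assume "\<exists>s\<in>{2..\<delta>}. n dvd r + s"
    then obtain s where s: "2 \<le> s" "s \<le> \<delta>" "n dvd r + s" by auto
    then have "n dvd r mod n + s" unfolding dvd_eq_mod_eq_0 mod_add_left_eq by simp
    then obtain c where c: "r mod n + s = n * c" by blast
    have r: "r mod n < n" using n_ge by simp
    \<comment> \<open>The sum lies strictly between 0 and \<open>2 * n\<close>, even for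
      \<open>s = n\<close>, because \<open>r mod n\<close> stays below n.\<close>
    then have "n * c < n * 2" "n * 0 < n * c" using c s assms by linarith+
    then have "c = 1" by simp
    then show "r mod n \<in> {n - \<delta>..n - 2}" using c s by auto
  next
    assume "r mod n \<in> {n - \<delta>..n - 2}"
    then have r: "n - \<delta> \<le> r mod n" "r mod n \<le> n - 2" by auto
    have "r mod n < n" using n_ge by simp
    then have "r + (n - r mod n) = n * (r div n) + n" using mult_div_mod_eq[of n r] by linarith
    then have "n dvd r + (n - r mod n)" by simp
    moreover have "n - r mod n \<in> {2..\<delta>}" using r n_ge by auto
    ultimately show "\<exists>s\<in>{2..\<delta>}. n dvd r + s" by blast
  qed
  then show ?thesis unfolding annihilator_def dual_zeros_def by blast
qed

text \<open>The code is BCH by construction, so only its dual matters. The dual zeros are closed, so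
  they are compared with closures of intervals.\<close>

theorem dually_bch_iff:
  assumes "2 \<le> \<delta>" "\<delta> \<le> n"
  shows "dually_bch h \<alpha> n (bch_code h \<alpha> n \<delta> 2) \<longleftrightarrow> 1 \<le> n - \<delta> \<and> n - \<delta> \<le> q ^ (m - 1) + q ^ ((m - 1) div 2)"
proof -
  have dual: "dual_code n (bch_code h \<alpha> n \<delta> 2) = zeros_code (dual_zeros q n \<delta>)"
    using annihilator_interval[OF assms(2)] by (simp add: bch_code_eq dual_zeros_code)
  have closed: "coset_closure q n (dual_zeros q n \<delta>) = dual_zeros q n \<delta>"
    using annihilator_interval[OF assms(2)] coset_closure_annihilator by metis
  have "is_bch_code h \<alpha> n (bch_code h \<alpha> n \<delta> 2)"
    unfolding is_bch_code_def using assms by (intro exI[of _ 2] exI[of _ \<delta>]) simp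
  moreover have "is_bch_code h \<alpha> n (zeros_code (dual_zeros q n \<delta>)) \<longleftrightarrow>
      (\<exists>b d. 1 \<le> b \<and> 2 \<le> d \<and> d \<le> n \<and> coset_closure q n {b..b + d - 2} = dual_zeros q n \<delta>)"
    unfolding is_bch_code_def bch_code_eq zeros_code_eq_iff closed by metis
  ultimately show ?thesis
    unfolding dually_bch_def dual dual_zeros_interval_iff[OF assms] by simp
qed

end

theorem theorem12:
  fixes h :: "'f::{field_gcd,finite} \<Rightarrow> 'e::{field,finite}"
    and \<alpha> :: 'e
    and q m n \<delta> :: nat
  assumes "field_hom h"
    and "CARD('f) = q"
    and "CARD('e) = q ^ m"
    and "UNIV - {0} = range (\<lambda>k::nat. \<alpha> ^ k)"
    and "primepow q"
    and "q \<ge> 3"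
    and "m \<ge> 2"
    and "n = q ^ m - 1"
    and "2 \<le> \<delta>"
    and "\<delta> \<le> n"
  shows "dually_bch h \<alpha> n (bch_code h \<alpha> n \<delta> 2) \<longleftrightarrow>
    (int q - 1) * int q ^ (m - 1) - int q ^ ((m - 1) div 2) - 1 \<le> int \<delta> \<and>
    int \<delta> \<le> int q ^ m - 2"
proof -
  interpret field_hom h by (rule assms(1))
  interpret primitive_root_setting h \<alpha> q m n
    using assms by unfold_locales auto
  \<comment> \<open>With \<open>q ^ m = n + 1\<close> the lower bound becomes
    \<open>n - q ^ (m - 1) - q ^ ((m - 1) div 2) \<le> \<delta>\<close>, and the upper one becomes
    \<open>1 \<le> n - \<delta>\<close>.\<close>
  have "int q ^ m = int n + 1" using Suc_n by (metis of_nat_Suc of_nat_power add.commute)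
  moreover have "int q ^ m = int q * int q ^ (m - 1)" using q_power_m by (metis of_nat_mult of_nat_power)
  moreover have "n - \<delta> \<le> q ^ (m - 1) + q ^ ((m - 1) div 2) \<longleftrightarrow>
      int n - int \<delta> \<le> int q ^ (m - 1) + int q ^ ((m - 1) div 2)"
    using assms(10) by (metis of_nat_add of_nat_diff of_nat_le_iff of_nat_power)
  ultimately show ?thesis
    unfolding dually_bch_iff[OF assms(9,10)] left_diff_distrib using assms(10) by auto
qed

end
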